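(* For all integers $1\le k\le n$ there exists a polynomial $f$ of degree $k$ in $n$ variables $x_1,\dots,x_n$ with real coefficients such that the level-$(k-1)$ Lasserre relaxation does not solve $\max_{x\in\{0,1\}^n}f(x)$ exactly: there exists $(y^n_I)_{I\subseteq[n]}\in\mathrm{Las}_{k-1}(f)$ with $\sum_{I\subseteq[n]}f(x_I)\,y^n_I>\max_{x\in\{0,1\}^n}f(x)$.
   Context: For $I\subseteq[n]$, $x_I\in\{0,1\}^n$ is the indicator vector of $I$. For an integer $d\ge 0$, $\mathcal{P}_d(n)$ is the family of subsets of $[n]$ of size at most $d$, and for $I\subseteq[n]$ the zeta vector $Z_I\in\mathbb{R}^{\mathcal{P}_d(n)}$ has entries $[Z_I]_J=1$ if $J\subseteq I$ and $0$ otherwise. For the unconstrained 0/1 maximization of $f:\{0,1\}^n\to\mathbb{R}$, the Lasserre relaxation at level $t$, $\mathrm{Las}_t(f)$, is the set of real vectors $(y^n_I)_{I\subseteq[n]}$ with $\sum_{I\subseteq[n]}y^n_I=1$ and $\sum_{I\subseteq[n]}y^n_IZ_IZ_I^\top\succeq0$ where $Z_I\in\mathbb{R}^{\mathcal{P}_t(n)}$ (positive semidefinite); the relaxation's objective value at $y$ is $\sum_{I\subseteq[n]}f(x_I)\,y^n_I$. *)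

theory Defs
  imports Complex_Main "HOL-Library.FuncSet" "HOL-Library.Poly_Mapping"
begin

text \<open>A monomial is the finitely supported map from variable indices to exponents, and a
  polynomial the finitely supported map from monomials to coefficients.\<close>

type_synonym real_mpoly = "(nat \<Rightarrow>\<^sub>0 nat) \<Rightarrow>\<^sub>0 real"

definition mpoly_vars :: "real_mpoly \<Rightarrow> nat set" where
  "mpoly_vars f = (\<Union>m\<in>Poly_Mapping.keys f. Poly_Mapping.keys m)"

definition mpoly_total_degree :: "real_mpoly \<Rightarrow> nat" where
  "mpoly_total_degree f =
     Max (insert 0 ((\<lambda>m. \<Sum>i\<in>Poly_Mapping.keys m. Poly_Mapping.lookup m i)
                      ` Poly_Mapping.keys f))"

definition mpoly_eval :: "real_mpoly \<Rightarrow> (nat \<Rightarrow> real) \<Rightarrow> real" where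
  "mpoly_eval f x =
     (\<Sum>m\<in>Poly_Mapping.keys f. Poly_Mapping.lookup f m *
        (\<Prod>i\<in>Poly_Mapping.keys m. x i ^ Poly_Mapping.lookup m i))"

text \<open>Vectors indexed by a finite set are extensional functions on that set.\<close>

definition hypercube :: "nat \<Rightarrow> (nat \<Rightarrow> real) set" where
  "hypercube n = {1..n} \<rightarrow>\<^sub>E {0, 1}"

definition indicator_vec :: "nat \<Rightarrow> nat set \<Rightarrow> nat \<Rightarrow> real" where
  "indicator_vec n I = (\<lambda>i\<in>{1..n}. if i \<in> I then 1 else 0)"

definition small_subsets :: "nat \<Rightarrow> nat \<Rightarrow> nat set set" where
  "small_subsets d n = {J. J \<subseteq> {1..n} \<and> card J \<le> d}"

definition zeta_vec :: "nat \<Rightarrow> nat \<Rightarrow> nat set \<Rightarrow> nat set \<Rightarrow> real" where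
  "zeta_vec d n I = (\<lambda>J\<in>small_subsets d n. if J \<subseteq> I then 1 else 0)"

definition psd_on :: "'a set \<Rightarrow> ('a \<Rightarrow> 'a \<Rightarrow> real) \<Rightarrow> bool" where
  "psd_on A M \<longleftrightarrow>
     (\<forall>i\<in>A. \<forall>j\<in>A. M i j = M j i) \<and>
     (\<forall>v. 0 \<le> (\<Sum>i\<in>A. \<Sum>j\<in>A. v i * M i j * v j))"

text \<open>For unconstrained problems the feasible set depends on the objective function only
  through the number \<open>n\<close> of variables.\<close>

definition lasserre :: "nat \<Rightarrow> nat \<Rightarrow> (nat set \<Rightarrow> real) set" where
  "lasserre t n =
     {y \<in> Pow {1..n} \<rightarrow>\<^sub>E UNIV.
        (\<Sum>I\<in>Pow {1..n}. y I) = 1 \<and>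
        psd_on (small_subsets t n)
          (\<lambda>J K. \<Sum>I\<in>Pow {1..n}. y I * (zeta_vec t n I J * zeta_vec t n I K))}"

end

theory Submission
  imports Defs "HOL-Analysis.Convex"
begin

text \<open>The objective is the single monomial \<open>f = -x\<^sub>1\<cdots>x\<^sub>k\<close>, whose maximum on the cube is
  \<open>0\<close>. Let \<open>y\<close> put the negative weight \<open>-1/N\<^sup>2\<close> on \<open>[k]\<close>, where \<open>N = 2\<^sup>k - 1\<close>, and
  spread the remaining mass evenly over the \<open>N\<close> proper subsets of \<open>[k]\<close>, so the relaxation attains
  \<open>1/N\<^sup>2 > 0\<close>. Feasibility says that \<open>\<Sum>\<^sub>I y\<^sub>I p(I)\<^sup>2 \<ge> 0\<close> for every polynomial function \<open>p\<close> of
  degree less than \<open>k\<close>. Such a \<open>p\<close> is orthogonal to the parity character on the subsets of \<open>[k]\<close>,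
  so \<open>p([k])\<close> is a signed sum of the other \<open>N\<close> values, and Cauchy-Schwarz gives
  \<open>p([k])\<^sup>2 \<le> N \<Sum>\<^sub>I p(I)\<^sup>2\<close> over the proper subsets \<open>I\<close>.\<close>

text \<open>If \<open>J\<close> is a proper subset of \<open>A\<close>, toggling a fixed element of
  \<open>A - J\<close> pairs the even sets of the interval with the odd ones. Otherwise the interval
  is empty.\<close>

lemma sum_alternating_between:
  assumes "finite A" and "J \<noteq> A"
  shows "(\<Sum>I | J \<subseteq> I \<and> I \<subseteq> A. (- 1) ^ card I) = (0 :: real)"
proof (cases "J \<subseteq> A")
  case False
  then have "{I. J \<subseteq> I \<and> I \<subseteq> A} = {}" by blast
  then show ?thesis by (simp only: sum.empty)
next
  case True
  with assms have "card {I. I \<subseteq> A \<and> J \<subseteq> I \<and> even (card I)} =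
      card {I. I \<subseteq> A \<and> J \<subseteq> I \<and> odd (card I)}"
    by (intro card_subsupersets_even_odd) auto
  with assms(1) show ?thesis
    by (intro sum_alternating_cancels) (simp_all add: conj_ac)
qed

text \<open>After exchanging the sums, each \<open>J\<close> contributes an alternating sum over an
  interval below \<open>A\<close>, which can be nonzero only for \<open>J = A\<close>.\<close>

lemma sum_alternating_subset_sums:
  fixes v :: "'a set \<Rightarrow> real"
  assumes "finite A" and "finite S" and "A \<notin> S"
  shows "(\<Sum>I\<in>Pow A. (- 1) ^ card I * (\<Sum>J\<in>S. v J * (if J \<subseteq> I then 1 else 0))) = 0"
proof -
  have "(\<Sum>I\<in>Pow A. (- 1) ^ card I * (\<Sum>J\<in>S. v J * (if J \<subseteq> I then 1 else 0))) =
      (\<Sum>J\<in>S. v J * (\<Sum>I\<in>Pow A. if J \<subseteq> I then (- 1) ^ card I else 0))"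
    by (subst sum_distrib_left, subst sum.swap)
      (auto simp: sum_distrib_left intro!: sum.cong)
  also have "\<dots> = (\<Sum>J\<in>S. v J * (\<Sum>I | J \<subseteq> I \<and> I \<subseteq> A. (- 1) ^ card I))"
    using assms(1)
    by (auto simp: sum.inter_filter [symmetric] Pow_def conj_commute intro!: sum.cong)
  also have "\<dots> = 0"
  proof (intro sum.neutral ballI)
    fix J assume "J \<in> S"
    with assms(3) have "J \<noteq> A" by blast
    with assms(1) have "(\<Sum>I | J \<subseteq> I \<and> I \<subseteq> A. (- 1) ^ card I) = (0 :: real)"
      by (rule sum_alternating_between)
    then show "v J * (\<Sum>I | J \<subseteq> I \<and> I \<subseteq> A. (- 1) ^ card I) = 0" by simp
  qed
  finally show ?thesis .
qed

text \<open>The hypothesis expresses \<open>p A\<close> as a signed sum of the other values.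
  Cauchy-Schwarz over these \<open>2 ^ card A - 1\<close> terms applies, and squaring removes the
  signs.\<close>

lemma square_top_le:
  fixes p :: "'a set \<Rightarrow> real"
  assumes "finite A" and "(\<Sum>I\<in>Pow A. (- 1) ^ card I * p I) = 0"
  shows "(p A)\<^sup>2 \<le> (2 ^ card A - 1) * (\<Sum>I\<in>Pow A - {A}. (p I)\<^sup>2)"
proof -
  let ?s = "\<lambda>I. (- 1) ^ card I * p I"
  have "?s A = - (\<Sum>I\<in>Pow A - {A}. ?s I)"
    using assms by (simp add: sum.remove [where x = A])
  then have "(?s A)\<^sup>2 = (\<Sum>I\<in>Pow A - {A}. ?s I)\<^sup>2"
    by simp
  also have "\<dots> \<le> (\<Sum>I\<in>Pow A - {A}. (?s I)\<^sup>2) * card (Pow A - {A})"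
    by (rule sum_squared_le_sum_of_squares)
  finally show ?thesis
    using assms(1) by (simp add: power_mult_distrib card_Pow of_nat_diff mult.commute
        flip: power_mult)
qed

lemma sum_Pow_supported:
  fixes g :: "'a set \<Rightarrow> real"
  assumes "finite B" and "A \<subseteq> B" and "\<And>I. I \<subseteq> B \<Longrightarrow> \<not> I \<subseteq> A \<Longrightarrow> g I = 0"
  shows "(\<Sum>I\<in>Pow B. g I) = g A + (\<Sum>I\<in>Pow A - {A}. g I)"
proof -
  have "finite (Pow A)"
    using assms by (auto intro: finite_subset)
  have "(\<Sum>I\<in>Pow B. g I) = (\<Sum>I\<in>Pow A. g I)"
    by (rule sum.mono_neutral_right) (use assms in auto)
  also have "\<dots> = g A + (\<Sum>I\<in>Pow A - {A}. g I)"
    by (rule sum.remove) (use \<open>finite (Pow A)\<close> in auto)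
  finally show ?thesis .
qed

text \<open>Each rank-one matrix of a zeta vector contributes the square of its inner product with
  \<open>v\<close>, so positivity becomes a statement about a weighted sum of squares.\<close>

lemma zeta_quadratic_form:
  "(\<Sum>J\<in>small_subsets t n. \<Sum>K\<in>small_subsets t n.
      v J * (\<Sum>I\<in>Pow {1..n}. y I * (zeta_vec t n I J * zeta_vec t n I K)) * v K) =
   (\<Sum>I\<in>Pow {1..n}. y I * (\<Sum>J\<in>small_subsets t n. v J * (if J \<subseteq> I then 1 else 0))\<^sup>2)"
proof -
  let ?S = "small_subsets t n"
  let ?z = "\<lambda>I J. zeta_vec t n I J"
  have "(\<Sum>J\<in>?S. \<Sum>K\<in>?S. v J * (\<Sum>I\<in>Pow {1..n}. y I * (?z I J * ?z I K)) * v K) =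
      (\<Sum>J\<in>?S. \<Sum>K\<in>?S. \<Sum>I\<in>Pow {1..n}. y I * ((v J * ?z I J) * (v K * ?z I K)))"
    by (simp add: sum_distrib_left sum_distrib_right mult_ac)
  also have "\<dots> = (\<Sum>J\<in>?S. \<Sum>I\<in>Pow {1..n}. \<Sum>K\<in>?S. y I * ((v J * ?z I J) * (v K * ?z I K)))"
    by (intro sum.cong refl sum.swap)
  also have "\<dots> = (\<Sum>I\<in>Pow {1..n}. \<Sum>J\<in>?S. \<Sum>K\<in>?S. y I * ((v J * ?z I J) * (v K * ?z I K)))"
    by (rule sum.swap)
  also have "\<dots> = (\<Sum>I\<in>Pow {1..n}. y I * (\<Sum>J\<in>?S. v J * ?z I J)\<^sup>2)"
    unfolding power2_eq_square by (simp only: sum_product) (simp add: sum_distrib_left)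
  also have "\<dots> = (\<Sum>I\<in>Pow {1..n}. y I * (\<Sum>J\<in>?S. v J * (if J \<subseteq> I then 1 else 0))\<^sup>2)"
    by (simp add: zeta_vec_def)
  finally show ?thesis .
qed

text \<open>With \<open>N = 2 ^ k - 1\<close>, a weight \<open>-e\<close> at the top is compatible
  with Cauchy-Schwarz as soon as \<open>e * N^2 \<le> 1 + e\<close>; the choice
  \<open>e = 1 / N^2\<close> meets this with room to spare.\<close>

definition top_negative_weights :: "nat \<Rightarrow> nat \<Rightarrow> nat set \<Rightarrow> real" where
  "top_negative_weights k n = (\<lambda>I\<in>Pow {1..n}.
     if I = {1..k} then - 1 / (2 ^ k - 1)\<^sup>2
     else if I \<subseteq> {1..k} then (1 + 1 / (2 ^ k - 1)\<^sup>2) / (2 ^ k - 1)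
     else 0)"

text \<open>The function \<open>g\<close> is arbitrary because three sums are evaluated this way:
  the total mass, the quadratic form and the objective.\<close>

lemma sum_top_negative_weights:
  assumes "k \<le> n"
  shows "(\<Sum>I\<in>Pow {1..n}. top_negative_weights k n I * g I) =
     - 1 / (2 ^ k - 1)\<^sup>2 * g {1..k}
     + (1 + 1 / (2 ^ k - 1)\<^sup>2) / (2 ^ k - 1) * (\<Sum>I\<in>Pow {1..k} - {{1..k}}. g I)"
proof -
  have sub: "{1..k} \<subseteq> {1..n}" using assms by auto
  have "(\<Sum>I\<in>Pow {1..n}. top_negative_weights k n I * g I) =
      top_negative_weights k n {1..k} * g {1..k}
      + (\<Sum>I\<in>Pow {1..k} - {{1..k}}. top_negative_weights k n I * g I)"
    by (rule sum_Pow_supported) (use sub in \<open>auto simp: top_negative_weights_def\<close>)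
  moreover have "top_negative_weights k n {1..k} = - 1 / (2 ^ k - 1)\<^sup>2"
    using sub by (simp add: top_negative_weights_def)
  moreover have "top_negative_weights k n I = (1 + 1 / (2 ^ k - 1)\<^sup>2) / (2 ^ k - 1)"
    if "I \<in> Pow {1..k} - {{1..k}}" for I
    using sub that by (auto simp: top_negative_weights_def)
  ultimately show ?thesis by (simp add: sum_distrib_left)
qed

lemma top_negative_weights_in_lasserre:
  assumes "1 \<le> k" and "k \<le> n"
  shows "top_negative_weights k n \<in> lasserre (k - 1) n"
proof -
  let ?y = "top_negative_weights k n"
  let ?S = "small_subsets (k - 1) n"
  define N :: real where "N = 2 ^ k - 1"
  have "(2::real) ^ 1 \<le> 2 ^ k"
    using assms(1) by (intro power_increasing) auto
  then have N: "N \<ge> 1" by (simp add: N_def)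
  have "?y \<in> Pow {1..n} \<rightarrow>\<^sub>E UNIV"
    by (simp add: top_negative_weights_def)
  moreover have "(\<Sum>I\<in>Pow {1..n}. ?y I) = 1"
  proof -
    have "real (card (Pow {1..k} - {{1..k}})) = N"
      by (simp add: card_Pow of_nat_diff N_def)
    then show ?thesis
      using sum_top_negative_weights [OF assms(2), of "\<lambda>_. 1"] N
      by (simp flip: N_def)
  qed
  moreover have "0 \<le> (\<Sum>I\<in>Pow {1..n}. ?y I * (\<Sum>J\<in>?S. v J * (if J \<subseteq> I then 1 else 0))\<^sup>2)"
    for v :: "nat set \<Rightarrow> real"
  proof -
    define p where "p I = (\<Sum>J\<in>?S. v J * (if J \<subseteq> I then 1 else 0))" for I
    define Q where "Q = (\<Sum>I\<in>Pow {1..k} - {{1..k}}. (p I)\<^sup>2)"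
    have "finite ?S"
      by (rule finite_subset [of _ "Pow {1..n}"]) (auto simp: small_subsets_def)
    \<comment> \<open>Here the level matters: \<open>{1..k}\<close> has \<open>k\<close> elements,
      and \<open>1 \<le> k\<close> keeps the truncated difference \<open>k - 1\<close> below
      \<open>k\<close>.\<close>
    moreover have "{1..k} \<notin> ?S"
      using assms(1) by (auto simp: small_subsets_def)
    ultimately have "(\<Sum>I\<in>Pow {1..k}. (- 1) ^ card I * p I) = 0"
      unfolding p_def by (intro sum_alternating_subset_sums) auto
    then have "(p {1..k})\<^sup>2 \<le> N * Q"
      using square_top_le [of "{1..k}" p] by (simp add: N_def Q_def)
    then have "(p {1..k})\<^sup>2 / N\<^sup>2 \<le> N * Q / N\<^sup>2"
      by (rule divide_right_mono) simp
    also have "\<dots> = 1 / N * Q"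
      using N by (simp add: power2_eq_square)
    \<comment> \<open>The extra mass that compensates the negative weight only helps, since
      \<open>Q\<close> is nonnegative.\<close>
    also have "\<dots> \<le> (1 + 1 / N\<^sup>2) / N * Q"
      using N by (intro mult_right_mono divide_right_mono) (auto simp: Q_def intro: sum_nonneg)
    finally show ?thesis
      unfolding p_def [symmetric] sum_top_negative_weights [OF assms(2)]
      unfolding N_def [symmetric] Q_def [symmetric] by simp
  qed
  ultimately show ?thesis
    unfolding lasserre_def psd_on_def zeta_quadratic_form by (auto simp: mult.commute)
qed

text \<open>Monomials are exponent maps, so the product of the variables is encoded as a sum of unit
  exponents.\<close>

definition neg_monomial :: "nat \<Rightarrow> real_mpoly" where
  "neg_monomial k = Poly_Mapping.single (\<Sum>i\<in>{1..k}. Poly_Mapping.single i 1) (- 1)"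

lemma lookup_sum_single:
  assumes "finite A"
  shows "Poly_Mapping.lookup (\<Sum>i\<in>A. Poly_Mapping.single i (1 :: nat)) j = (if j \<in> A then 1 else 0)"
  using assms by (simp add: lookup_sum lookup_single when_def)

lemma keys_sum_single:
  assumes "finite A"
  shows "Poly_Mapping.keys (\<Sum>i\<in>A. Poly_Mapping.single i (1 :: nat)) = A"
  using assms by (auto simp: in_keys_iff lookup_sum_single simp del: One_nat_def split: if_splits)

lemma mpoly_vars_neg_monomial: "mpoly_vars (neg_monomial k) = {1..k}"
  by (simp add: mpoly_vars_def neg_monomial_def keys_sum_single del: One_nat_def)

lemma mpoly_total_degree_neg_monomial: "mpoly_total_degree (neg_monomial k) = k"
  by (simp add: mpoly_total_degree_def neg_monomial_def keys_sum_single lookup_sum_single del: One_nat_def)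

lemma mpoly_eval_neg_monomial: "mpoly_eval (neg_monomial k) x = - (\<Prod>i\<in>{1..k}. x i)"
  by (simp add: mpoly_eval_def neg_monomial_def keys_sum_single lookup_sum_single del: One_nat_def)

lemma mpoly_eval_neg_monomial_indicator:
  assumes "k \<le> n"
  shows "mpoly_eval (neg_monomial k) (indicator_vec n I) = (if {1..k} \<subseteq> I then - 1 else 0)"
proof -
  have "(\<Prod>i\<in>{1..k}. indicator_vec n I i) = (\<Prod>i\<in>{1..k}. if i \<in> I then 1 else 0)"
    using assms by (intro prod.cong) (auto simp: indicator_vec_def)
  also have "\<dots> = (if {1..k} \<subseteq> I then 1 else 0)"
    by (auto intro!: prod.neutral simp del: One_nat_def)
  finally show ?thesis by (simp add: mpoly_eval_neg_monomial)
qed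

lemma Max_neg_monomial_le:
  assumes "k \<le> n"
  shows "Max (mpoly_eval (neg_monomial k) ` hypercube n) \<le> 0"
proof (rule Max.boundedI)
  show "finite (mpoly_eval (neg_monomial k) ` hypercube n)"
    by (auto simp: hypercube_def intro!: finite_PiE)
  show "mpoly_eval (neg_monomial k) ` hypercube n \<noteq> {}"
    by (simp add: hypercube_def PiE_eq_empty_iff)
  show "a \<le> 0" if "a \<in> mpoly_eval (neg_monomial k) ` hypercube n" for a
  proof -
    from that obtain x where x: "x \<in> {1..n} \<rightarrow>\<^sub>E {0, 1}" and a: "a = - (\<Prod>i\<in>{1..k}. x i)"
      by (auto simp: hypercube_def mpoly_eval_neg_monomial)
    have "0 \<le> x i" if "i \<in> {1..k}" for i
      using PiE_mem [OF x, of i] that assms by auto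
    then have "0 \<le> (\<Prod>i\<in>{1..k}. x i)" by (rule prod_nonneg)
    with a show ?thesis by simp
  qed
qed

theorem theorem3:
  fixes k n :: nat
  assumes "1 \<le> k" and "k \<le> n"
  shows "\<exists>f :: real_mpoly.
           mpoly_vars f \<subseteq> {1..n} \<and> mpoly_total_degree f = k \<and>
           (\<exists>y \<in> lasserre (k - 1) n.
              (\<Sum>I\<in>Pow {1..n}. mpoly_eval f (indicator_vec n I) * y I)
                > Max (mpoly_eval f ` hypercube n))"
proof (intro exI conjI bexI)
  show "mpoly_vars (neg_monomial k) \<subseteq> {1..n}"
    using assms(2) by (simp add: mpoly_vars_neg_monomial)
  show "mpoly_total_degree (neg_monomial k) = k"
    by (rule mpoly_total_degree_neg_monomial)
  show "top_negative_weights k n \<in> lasserre (k - 1) n"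
    using assms by (rule top_negative_weights_in_lasserre)
  let ?f = "\<lambda>I. mpoly_eval (neg_monomial k) (indicator_vec n I)"
  have "Max (mpoly_eval (neg_monomial k) ` hypercube n) \<le> 0"
    using assms(2) by (rule Max_neg_monomial_le)
  also have "(2::real) ^ 1 \<le> 2 ^ k"
    using assms(1) by (intro power_increasing) auto
  then have "0 < 1 / (2 ^ k - 1 :: real)\<^sup>2"
    by simp
  also have "\<dots> = (\<Sum>I\<in>Pow {1..n}. top_negative_weights k n I * ?f I)"
  proof -
    \<comment> \<open>The monomial vanishes on proper subsets, so the objective is the single
      product of \<open>-1\<close> with the negative weight at \<open>{1..k}\<close>.\<close>
    have "(\<Sum>I\<in>Pow {1..k} - {{1..k}}. ?f I) = 0"
      using assms(2) by (intro sum.neutral) (auto simp: mpoly_eval_neg_monomial_indicator)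
    then show ?thesis
      using assms(2)
      by (simp only: sum_top_negative_weights mpoly_eval_neg_monomial_indicator) simp
  qed
  finally show "(\<Sum>I\<in>Pow {1..n}. ?f I * top_negative_weights k n I) >
      Max (mpoly_eval (neg_monomial k) ` hypercube n)"
    by (simp add: mult.commute)
qed

end
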